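(* Let $k,m\ge 1$ and, for $n\ge 1$, let $\mathcal{J}_{n,k}^m$ be the hyperplane arrangement in $$\{(x_1,\dots,x_n,y^{(1)},\dots,y^{(k)})\mid x_i,y^{(j)}\in\mathbb{C}\}=\mathbb{C}^{n+k}$$ given by $$\mathcal{J}_{n,k}^m=\{x_1-\omega^{p}x_j=y^{(\ell)}\mid 1<j\le n,\ 0\le p\le m-1,\ 1\le \ell\le k\}\cup\{x_1=y^{(\ell)}\mid 1\le \ell\le k\},$$ where $\omega=e^{2\pi\sqrt{-1}/m}$. Then $\chi_{\mathcal{J}_{1,k}^m}(t)=(t-1)^k$ and $$\sum_{n\geq 2}\chi_{\mathcal{J}_{n,k}^m}(t)\,u^{n-1}=\sum_{n\geq 2}\frac{(t-1)_{n-1,m}\left[(t-1-m(n-1))^k+(m(n-2)+1)(t-1-m(n-2))^{k-1}\right]u^{n-1}}{\prod_{i=0}^{n-2}\left[1-(mi+1)u\right]}.$$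
   Context: $(x)_{n,m}=x(x-m)\cdots(x-(n-1)m)$, with $(x)_{0,m}=1$. The identity is one of formal power series in $u$ with coefficients in $\mathbb{Z}[t]$. For an arrangement $\mathcal{J}$, $\chi_{\mathcal{J}}(t)$ denotes the characteristic polynomial $\chi_{\mathcal{L}(\mathcal{J})}(t)$ of its intersection poset $\mathcal{L}(\mathcal{J})$: all intersections of hyperplanes of $\mathcal{J}$ (including the whole space), ordered by reverse inclusion. For a finite ranked poset $P$ with bottom $\hat 0$, $\chi_P(t)=\sum_{X\in P}\mu_P(\hat 0,X)\,t^{\mathrm{rk}(P)-\mathrm{rk}(X)}$, where $\mu_P$ is the Möbius function and $\mathrm{rk}(P)$ is the length of $P$. *)

theory Defs
  imports "HOL-Analysis.Infinite_Sum" "HOL-Library.FuncSet"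
    "HOL-Computational_Algebra.Formal_Power_Series" "HOL-Computational_Algebra.Polynomial"
begin

section \<open>Finite posets\<close>

text \<open>
  A poset is given by its order relation \<open>r\<close>, as in the library theory \<open>Order_Relation\<close>:
  the carrier is \<open>Field r\<close>, and \<open>(x, y) \<in> r\<close> means \<open>x \<le> y\<close>.
  The first condition below only serves termination.
\<close>

function mobius :: "'a rel \<Rightarrow> 'a \<Rightarrow> 'a \<Rightarrow> int" where
  "mobius r x y =
     (if \<not> (finite (Field r) \<and> Partial_order r) \<or> (x, y) \<notin> r then 0
      else if x = y then 1
      else - (\<Sum>z\<in>{z. (x, z) \<in> r \<and> (z, y) \<in> r \<and> z \<noteq> y}. mobius r x z))"
  by pat_completeness auto
termination
proof (relation "measure (\<lambda>(r, x, y). card (under r y))", goal_cases)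
  case 1
  then show ?case by simp
next
  case (2 r x y z)
  then have fin: "finite (Field r)" and po: "Partial_order r" and zy: "(z, y) \<in> r" "z \<noteq> y"
    and xy: "(x, y) \<in> r"
    by auto
  have "refl_on (Field r) r" "trans r" "antisym r"
    using po by (auto simp: order_on_defs)
  then have "under r z \<subseteq> under r y" "y \<in> under r y" "y \<notin> under r z"
    using zy xy unfolding under_def
    by (auto dest: transD antisymD refl_onD intro: FieldI2)
  then have "under r z \<subset> under r y" by blast
  moreover have "finite (under r y)"
    using fin by (rule finite_subset[OF under_Field])
  ultimately show ?case by (simp add: psubset_card_mono)
qed

declare mobius.simps [simp del]

definition poset_bot :: "'a rel \<Rightarrow> 'a" where
  "poset_bot r = (THE b. b \<in> Field r \<and> (\<forall>x\<in>Field r. (b, x) \<in> r))"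

text \<open>The length of a chain is its number of elements minus one.\<close>

definition poset_length :: "'a rel \<Rightarrow> nat" where
  "poset_length r = Max ((\<lambda>C. card C - 1) ` Chains r)"

text \<open>
  The rank of \<open>x\<close> is the length of the lower interval \<open>{z. z \<le> x}\<close>; for a ranked poset with
  bottom this is the common length of all its maximal chains.
\<close>

definition poset_rank :: "'a rel \<Rightarrow> 'a \<Rightarrow> nat" where
  "poset_rank r x = poset_length (Restr r (under r x))"

definition char_poly_poset :: "'a rel \<Rightarrow> int poly" where
  "char_poly_poset r =
     (\<Sum>x\<in>Field r. monom (mobius r (poset_bot r) x) (poset_length r - poset_rank r x))"


section \<open>Intersection posets\<close>

text \<open>
  \<open>V\<close> is the ambient space and \<open>A\<close> a set of hyperplanes in \<open>V\<close>, each given as a set of points.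
  The case \<open>B = {}\<close> contributes \<open>V\<close> itself.
\<close>

definition intersections :: "'v set \<Rightarrow> 'v set set \<Rightarrow> 'v set set" where
  "intersections V A = {V \<inter> \<Inter>B | B. B \<subseteq> A}"

definition intersection_poset :: "'v set \<Rightarrow> 'v set set \<Rightarrow> 'v set rel" where
  "intersection_poset V A =
     {(X, Y). X \<in> intersections V A \<and> Y \<in> intersections V A \<and> Y \<subseteq> X}"

lemma Field_intersection_poset [simp]: "Field (intersection_poset V A) = intersections V A"
  unfolding intersection_poset_def Field_def by auto

lemma Partial_order_intersection_poset: "Partial_order (intersection_poset V A)"
  unfolding order_on_defs Field_intersection_poset
  by (auto simp: intersection_poset_def refl_on_def trans_def antisym_def)

lemma finite_intersections: "finite A \<Longrightarrow> finite (intersections V A)"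
proof -
  have "intersections V A = (\<lambda>B. V \<inter> \<Inter>B) ` Pow A"
    unfolding intersections_def by auto
  then show "finite A \<Longrightarrow> finite (intersections V A)" by simp
qed

lemma poset_bot_intersection_poset [simp]: "poset_bot (intersection_poset V A) = V"
proof -
  have V: "V \<in> intersections V A"
    unfolding intersections_def by (rule CollectI, rule exI[of _ "{}"]) simp
  moreover have "X \<subseteq> V" if "X \<in> intersections V A" for X
    using that unfolding intersections_def by auto
  ultimately show ?thesis
    unfolding poset_bot_def Field_intersection_poset
    by (intro the_equality) (auto simp: intersection_poset_def)
qed

definition char_poly_arr :: "'v set \<Rightarrow> 'v set set \<Rightarrow> int poly" where
  "char_poly_arr V A = char_poly_poset (intersection_poset V A)"


section \<open>The arrangements\<close>

text \<open>
  A point of \<open>\<complex>\<^sup>n\<^sup>+\<^sup>k\<close> is a pair \<open>(x, y)\<close> of coordinate families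
  \<open>x 1, \<dots>, x n\<close> and \<open>y 1, \<dots>, y k\<close>; the functions are extensional, so that
  points are determined by these coordinates.
\<close>

definition ambient :: "nat \<Rightarrow> nat \<Rightarrow> ((nat \<Rightarrow> complex) \<times> (nat \<Rightarrow> complex)) set" where
  "ambient n k = ({1..n} \<rightarrow>\<^sub>E UNIV) \<times> ({1..k} \<rightarrow>\<^sub>E UNIV)"

definition omega :: "nat \<Rightarrow> complex" where
  "omega m = exp (2 * of_real pi * \<i> / of_nat m)"

definition arr_J :: "nat \<Rightarrow> nat \<Rightarrow> nat \<Rightarrow> ((nat \<Rightarrow> complex) \<times> (nat \<Rightarrow> complex)) set set" where
  "arr_J m n k =
     {{(x, y) \<in> ambient n k. x 1 - omega m ^ p * x j = y l} | j p l.
        1 < j \<and> j \<le> n \<and> p \<le> m - 1 \<and> 1 \<le> l \<and> l \<le> k} \<union>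
     {{(x, y) \<in> ambient n k. x 1 = y l} | l. 1 \<le> l \<and> l \<le> k}"

lemma finite_arr_J: "finite (arr_J m n k)"
proof -
  have "arr_J m n k \<subseteq>
     (\<lambda>(j, p, l). {(x, y) \<in> ambient n k. x 1 - omega m ^ p * x j = y l})
        ` ({..n} \<times> {..m} \<times> {..k}) \<union>
     (\<lambda>l. {(x, y) \<in> ambient n k. x 1 = y l}) ` {..k}"
    unfolding arr_J_def by (fastforce simp: image_iff)
  then show ?thesis by (rule finite_subset) simp
qed

definition chi_J :: "nat \<Rightarrow> nat \<Rightarrow> nat \<Rightarrow> int poly" where
  "chi_J m n k = char_poly_arr (ambient n k) (arr_J m n k)"


section \<open>Power series with coefficients in \<open>\<int>[t]\<close>\<close>

text \<open>The indeterminate \<open>t\<close>; the indeterminate \<open>u\<close> of the power series is \<open>fps_X\<close>.\<close>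

abbreviation tvar :: "int poly" where
  "tvar \<equiv> [:0, 1:]"

definition gfalling :: "'a::comm_ring_1 \<Rightarrow> nat \<Rightarrow> nat \<Rightarrow> 'a" where
  "gfalling x n m = (\<Prod>i<n. x - of_nat (i * m))"

text \<open>
  The library's \<open>inverse\<close> on power series requires an \<open>inverse\<close> on the coefficients, which
  \<open>int poly\<close> lacks; for series with constant term \<open>1\<close> the following is the inverse.
\<close>

definition fps_unit_inverse :: "'a::comm_ring_1 fps \<Rightarrow> 'a fps" where
  "fps_unit_inverse f = fps_right_inverse f 1"

lemma fps_unit_inverse: "fps_nth f 0 = 1 \<Longrightarrow> f * fps_unit_inverse f = 1"
  unfolding fps_unit_inverse_def by (rule fps_right_inverse) simp

definition denom :: "nat \<Rightarrow> nat \<Rightarrow> int poly fps" where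
  "denom m n = (\<Prod>i\<in>{0..n - 2}. 1 - fps_const (of_nat (m * i + 1)) * fps_X)"

lemma denom_unit: "denom m n * fps_unit_inverse (denom m n) = 1"
proof (rule fps_unit_inverse)
  have "fps_nth (\<Prod>i\<in>I. 1 - fps_const (c i) * fps_X) 0 = 1" if "finite I"
    for I :: "nat set" and c :: "nat \<Rightarrow> int poly"
    using that by (induction I) auto
  then show "fps_nth (denom m n) 0 = 1"
    unfolding denom_def by simp
qed

end

theory Submission
  imports Defs
begin

text \<open>
  The characteristic polynomial is computed by a finite field method in which no finite field
  occurs. In the coordinates \<open>x\<^sub>2, \<dots>, x\<^sub>n\<close> and \<open>z\<^sub>l = x\<^sub>1 - y\<^sub>l\<close> the hyperplanes are \<open>z\<^sub>l = 0\<close> and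
  \<open>z\<^sub>l = \<omega>\<^sup>p x\<^sub>j\<close>, equations that involve only the multiplication by roots of unity. They therefore
  make sense over every finite set \<open>K \<subseteq> \<complex>\<close> that consists of zero and \<open>L\<close> orbits of the \<open>m\<close>-th
  roots of unity, and \<open>q = 1 + mL\<close>, the size of \<open>K\<close>, takes infinitely many values. Gaussian
  elimination with monomial equations shows that a flat has \<open>q\<^sup>d\<close> points with coordinates in \<open>K\<close>,
  where \<open>d\<close> is the number of its free coordinates (\<open>solved_form_Int\<close>, \<open>card_solved_form\<close>). Moebius
  inversion then identifies the value of the characteristic polynomial at \<open>q\<close> with the number of
  points over \<open>K\<close> off all hyperplanes (\<open>poly_char_poly_arr\<close>).

  To count these points, choose the \<open>x\<^sub>j\<close> one after the other. If \<open>i\<close> nonzero orbits are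
  occupied, the next \<open>x\<^sub>j\<close> has \<open>mi + 1\<close> choices that occupy no new orbit and \<open>q - 1 - mi\<close> choices
  that do; finally each \<open>z\<^sub>l\<close> has to avoid the \<open>mi + 1\<close> occupied points. For the generating functions
  \<open>S\<^sub>i\<close> of these counts in the number of remaining \<open>x\<^sub>j\<close> this says
  \<open>(1 - (mi + 1) u) S\<^sub>i = (t - 1 - mi)\<^sup>k + (t - 1 - mi) u S\<^sub>i\<^sub>+\<^sub>1\<close>.
  Here \<open>S\<^sub>0\<close> without its constant term is the left hand side of the identity. Iterating the
  recursion gives the right hand side as a telescoping sum (\<open>series_tail_step\<close>).
\<close>

section \<open>Characteristic polynomials by counting points\<close>

text \<open>
  The finite set \<open>P\<close> of test points replaces the vector space over \<open>\<F>\<^sub>q\<close> of the finite field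
  method. Every hyperplane that cuts a flat properly keeps exactly one \<open>q\<close>-th of its test
  points, and one test point lies in the centre; so a flat of codimension \<open>r\<close> has
  \<open>q\<close> to the power \<open>rank - r\<close> test points.
\<close>

locale counted_arrangement =
  fixes V :: "'v set" and A :: "'v set set" and P :: "'v set" and q :: nat
  assumes finite_A: "finite A" and finite_P: "finite P" and P_sub: "P \<subseteq> V"
    and q_gt1: "q > 1"
    and proper: "\<And>H. H \<in> A \<Longrightarrow> \<not> V \<subseteq> H"
    and cut: "\<And>X H. X \<in> intersections V A \<Longrightarrow> H \<in> A \<Longrightarrow> \<not> X \<subseteq> H \<Longrightarrow>
                q * card (X \<inter> H \<inter> P) = card (X \<inter> P)"
    and centre: "card (V \<inter> \<Inter>A \<inter> P) = 1"
begin

abbreviation flats :: "'v set set" where "flats \<equiv> intersections V A"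

abbreviation flat_order :: "'v set rel" where "flat_order \<equiv> intersection_poset V A"

definition flat_dim :: "'v set \<Rightarrow> nat" where
  "flat_dim X = (THE d. card (X \<inter> P) = q ^ d)"

lemma V_flat: "V \<in> flats"
  unfolding intersections_def by (rule CollectI, rule exI[of _ "{}"]) simp

lemma centre_flat: "V \<inter> \<Inter>A \<in> flats"
  unfolding intersections_def by blast

lemma Int_flat: "X \<in> flats \<Longrightarrow> B \<subseteq> A \<Longrightarrow> X \<inter> \<Inter>B \<in> flats"
  unfolding intersections_def
  by (clarify, rule_tac x="B \<union> Ba" in exI) (auto simp: Inf_union_distrib)

lemma centre_subset: "X \<in> flats \<Longrightarrow> V \<inter> \<Inter>A \<subseteq> X"
  unfolding intersections_def by auto

lemma flat_subset_V: "X \<in> flats \<Longrightarrow> X \<subseteq> V"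
  unfolding intersections_def by auto

lemma finite_flats: "finite flats"
  using finite_A by (rule finite_intersections)

text \<open>
  Cutting \<open>X\<close> successively with all hyperplanes ends in the centre, which has one test point;
  each step divides the number of test points by \<open>1\<close> or by \<open>q\<close>.
\<close>

lemma card_flat: "X \<in> flats \<Longrightarrow> card (X \<inter> P) = q ^ flat_dim X"
proof -
  assume X: "X \<in> flats"
  have "\<exists>d. card (X \<inter> P) = q ^ d * card (X \<inter> \<Inter>B \<inter> P)" if "B \<subseteq> A" "finite B" for B
    using that(2,1)
  proof (induction B)
    case empty
    show ?case by (rule exI[of _ 0]) simp
  next
    case (insert H B)
    then obtain d where d: "card (X \<inter> P) = q ^ d * card (X \<inter> \<Inter>B \<inter> P)" by auto
    have fl: "X \<inter> \<Inter>B \<in> flats" using Int_flat[OF X] insert.prems by auto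
    have eq: "X \<inter> \<Inter>(insert H B) = X \<inter> \<Inter>B \<inter> H" by auto
    show ?case
    proof (cases "X \<inter> \<Inter>B \<subseteq> H")
      case True
      then have "X \<inter> \<Inter>B \<inter> H = X \<inter> \<Inter>B" by auto
      with d show ?thesis unfolding eq by auto
    next
      case False
      then have "q * card (X \<inter> \<Inter>B \<inter> H \<inter> P) = card (X \<inter> \<Inter>B \<inter> P)"
        using cut[OF fl] insert.prems by auto
      with d have "card (X \<inter> P) = q ^ Suc d * card (X \<inter> \<Inter>B \<inter> H \<inter> P)"
        by (metis mult.assoc power_Suc2)
      then show ?thesis unfolding eq by blast
    qed
  qed
  from this[OF subset_refl finite_A] obtain d
    where "card (X \<inter> P) = q ^ d * card (X \<inter> \<Inter>A \<inter> P)" by auto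
  moreover have "X \<inter> \<Inter>A = V \<inter> \<Inter>A"
    using centre_subset[OF X] flat_subset_V[OF X] by auto
  ultimately have "card (X \<inter> P) = q ^ d" using centre by simp
  then show ?thesis
    unfolding flat_dim_def using q_gt1 by (rule_tac theI') (auto simp: power_inject_exp)
qed

lemma flat_dim_Int:
  assumes "X \<in> flats" "H \<in> A" "\<not> X \<subseteq> H"
  shows "flat_dim X = Suc (flat_dim (X \<inter> H))"
proof -
  have "X \<inter> H \<in> flats" using Int_flat[of X "{H}"] assms by auto
  then have "q ^ Suc (flat_dim (X \<inter> H)) = q ^ flat_dim X"
    using cut[OF assms] card_flat assms(1) by auto
  then show ?thesis using q_gt1 by (metis power_inject_exp)
qed

lemma flat_dim_mono: "X \<in> flats \<Longrightarrow> Y \<in> flats \<Longrightarrow> X \<subseteq> Y \<Longrightarrow> flat_dim X \<le> flat_dim Y"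
proof -
  assume "X \<in> flats" "Y \<in> flats" "X \<subseteq> Y"
  moreover from \<open>X \<subseteq> Y\<close> have "card (X \<inter> P) \<le> card (Y \<inter> P)"
    using finite_P by (intro card_mono) auto
  ultimately show ?thesis
    using card_flat q_gt1 by (metis power_le_imp_le_exp)
qed

lemma flat_dim_strict_mono:
  assumes X: "X \<in> flats" and Y: "Y \<in> flats" and "X \<subset> Y"
  shows "flat_dim X < flat_dim Y"
proof -
  from X obtain B where B: "B \<subseteq> A" "X = V \<inter> \<Inter>B" unfolding intersections_def by auto
  with \<open>X \<subset> Y\<close> flat_subset_V[OF Y] obtain H where H: "H \<in> B" "\<not> Y \<subseteq> H" by auto
  then have "X \<subseteq> Y \<inter> H" using B \<open>X \<subset> Y\<close> by auto
  moreover have "Y \<inter> H \<in> flats" using Int_flat[of Y "{H}"] Y H B by auto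
  ultimately have "flat_dim X \<le> flat_dim (Y \<inter> H)" using flat_dim_mono X by auto
  then show ?thesis using flat_dim_Int[OF Y, of H] H B by auto
qed

lemma Chains_order_subset: "C \<in> Chains flat_order \<Longrightarrow> C \<subseteq> flats"
  unfolding Chains_def intersection_poset_def by auto

text \<open>
  Write \<open>X\<close> as an intersection of hyperplanes and add them one at a time: each one that
  changes the current flat lowers the dimension by exactly \<open>1\<close>.
\<close>

lemma ex_maximal_chain:
  assumes "X \<in> flats"
  shows "\<exists>C. C \<in> Chains flat_order \<and> C \<subseteq> {Y. X \<subseteq> Y} \<and> card C = Suc (flat_dim V - flat_dim X)"
proof -
  have "\<exists>C. C \<in> Chains flat_order \<and> C \<subseteq> {Y. V \<inter> \<Inter>B \<subseteq> Y} \<and>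
           card C = Suc (flat_dim V - flat_dim (V \<inter> \<Inter>B))" if "B \<subseteq> A" "finite B" for B
    using that(2,1)
  proof (induction B)
    case empty
    show ?case
      by (rule exI[of _ "{V}"]) (use V_flat in \<open>auto simp: Chains_def intersection_poset_def\<close>)
  next
    case (insert H B)
    then obtain C where C: "C \<in> Chains flat_order" "C \<subseteq> {Y. V \<inter> \<Inter>B \<subseteq> Y}"
        "card C = Suc (flat_dim V - flat_dim (V \<inter> \<Inter>B))" by auto
    have fl: "V \<inter> \<Inter>B \<in> flats" using Int_flat[OF V_flat] insert.prems by auto
    have eq: "V \<inter> \<Inter>(insert H B) = V \<inter> \<Inter>B \<inter> H" by auto
    show ?case
    proof (cases "V \<inter> \<Inter>B \<subseteq> H")
      case True
      then have "V \<inter> \<Inter>B \<inter> H = V \<inter> \<Inter>B" by auto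
      with C show ?thesis unfolding eq by auto
    next
      case False
      let ?X = "V \<inter> \<Inter>B \<inter> H"
      have fX: "?X \<in> flats"
        using Int_flat[OF fl, of "{H}"] insert.prems by auto
      have flC: "Y \<in> flats" if "Y \<in> C" for Y
        using C(1) that unfolding Chains_def intersection_poset_def by auto
      have "?X \<notin> C" using C(2) False by auto
      moreover have "finite C" using C(3) card.infinite by fastforce
      moreover have "insert ?X C \<in> Chains flat_order"
        using C(1,2) fX flC unfolding Chains_def intersection_poset_def by auto
      moreover have "flat_dim (V \<inter> \<Inter>B) = Suc (flat_dim ?X)"
        using flat_dim_Int[OF fl _ False] insert.prems by auto
      moreover have "flat_dim (V \<inter> \<Inter>B) \<le> flat_dim V"
        using flat_dim_mono[OF fl V_flat] by auto
      ultimately show ?thesis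
        unfolding eq using C(2,3) by (intro exI[of _ "insert ?X C"]) auto
    qed
  qed
  then show ?thesis
    using assms finite_subset[OF _ finite_A] unfolding intersections_def by auto
qed

text \<open>
  The members of a chain have distinct dimensions, all between those of \<open>X\<close> and of \<open>V\<close>.
\<close>

lemma chain_card_le:
  assumes X: "X \<in> flats" and C: "C \<in> Chains flat_order" "C \<subseteq> {Y. X \<subseteq> Y}"
  shows "card C \<le> Suc (flat_dim V - flat_dim X)"
proof -
  have fl: "Y \<in> flats" if "Y \<in> C" for Y
    using C(1) that unfolding Chains_def intersection_poset_def by auto
  have "inj_on flat_dim C"
  proof (rule inj_onI, rule ccontr)
    fix Y Z assume *: "Y \<in> C" "Z \<in> C" "flat_dim Y = flat_dim Z" "Y \<noteq> Z"
    then have "Y \<subset> Z \<or> Z \<subset> Y"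
      using C(1) unfolding Chains_def intersection_poset_def by auto
    with * flat_dim_strict_mono fl show False by fastforce
  qed
  moreover have "flat_dim ` C \<subseteq> {flat_dim X..flat_dim V}"
    using fl flat_dim_mono X V_flat flat_subset_V C(2) by auto
  ultimately have "card C \<le> card {flat_dim X..flat_dim V}"
    by (intro card_inj_on_le) auto
  then show ?thesis by auto
qed

lemma poset_rank_flat:
  assumes X: "X \<in> flats"
  shows "poset_rank flat_order X = flat_dim V - flat_dim X"
proof -
  have under: "under flat_order X = {Y \<in> flats. X \<subseteq> Y}"
    using X unfolding under_def intersection_poset_def by auto
  have chains: "C \<in> Chains (Restr flat_order (under flat_order X)) \<longleftrightarrow>
          C \<in> Chains flat_order \<and> C \<subseteq> {Y. X \<subseteq> Y}" for C
  proof
    assume C: "C \<in> Chains (Restr flat_order (under flat_order X))"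
    have "C \<in> Chains flat_order" using C unfolding Chains_def by blast
    moreover have "C \<subseteq> under flat_order X" using C unfolding Chains_def by blast
    ultimately show "C \<in> Chains flat_order \<and> C \<subseteq> {Y. X \<subseteq> Y}" unfolding under by blast
  next
    assume C: "C \<in> Chains flat_order \<and> C \<subseteq> {Y. X \<subseteq> Y}"
    then have "C \<subseteq> flats" using Chains_order_subset by blast
    with C have "C \<subseteq> under flat_order X" unfolding under by blast
    with C show "C \<in> Chains (Restr flat_order (under flat_order X))" unfolding Chains_def by blast
  qed
  have fin: "finite (Chains (Restr flat_order (under flat_order X)))"
  proof (rule finite_subset)
    show "Chains (Restr flat_order (under flat_order X)) \<subseteq> Pow flats"
      using chains Chains_order_subset by blast
    show "finite (Pow flats)" using finite_flats by simp
  qed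
  show ?thesis
    unfolding poset_rank_def poset_length_def
  proof (rule Max_eqI)
    fix d assume "d \<in> (\<lambda>C. card C - 1) ` Chains (Restr flat_order (under flat_order X))"
    then show "d \<le> flat_dim V - flat_dim X"
      by (elim imageE) (use chain_card_le[OF X] chains in force)
  next
    from ex_maximal_chain[OF X] obtain C
      where "C \<in> Chains (Restr flat_order (under flat_order X))"
        "card C = Suc (flat_dim V - flat_dim X)" using chains by meson
    then show "flat_dim V - flat_dim X
          \<in> (\<lambda>C. card C - 1) ` Chains (Restr flat_order (under flat_order X))"
      by (intro rev_image_eqI[of C]) auto
  qed (use fin in simp)
qed

lemma poset_length_flats: "poset_length flat_order = flat_dim V"
proof -
  let ?Z = "V \<inter> \<Inter>A"
  have "under flat_order ?Z = flats"
    using centre_flat centre_subset unfolding under_def intersection_poset_def by auto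
  then have "Restr flat_order (under flat_order ?Z) = flat_order"
    unfolding intersection_poset_def by auto
  moreover have "flat_dim ?Z = 0"
  proof -
    have "q ^ flat_dim ?Z = q ^ 0" using card_flat[OF centre_flat] centre by simp
    then show ?thesis using q_gt1 by (metis power_inject_exp)
  qed
  ultimately show ?thesis
    using poset_rank_flat[OF centre_flat] unfolding poset_rank_def by simp
qed

text \<open>
  This is the defining recursion of the Moebius function: the flats that contain \<open>X\<close> form the
  interval between the bottom \<open>V\<close> and \<open>X\<close>.
\<close>

lemma sum_mobius_lower:
  assumes X: "X \<in> flats"
  shows "(\<Sum>Y | Y \<in> flats \<and> X \<subseteq> Y. mobius flat_order V Y) = (if X = V then 1 else 0)"
proof (cases "X = V")
  case True
  then have "{Y. Y \<in> flats \<and> X \<subseteq> Y} = {V}" using V_flat flat_subset_V by auto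
  moreover have "mobius flat_order V V = 1"
    using V_flat finite_flats Partial_order_intersection_poset[of V A]
    by (subst mobius.simps) (simp, simp add: intersection_poset_def)
  ultimately show ?thesis using True by simp
next
  case False
  let ?S = "{Y. (V, Y) \<in> flat_order \<and> (Y, X) \<in> flat_order \<and> Y \<noteq> X}"
  have eq: "{Y. Y \<in> flats \<and> X \<subseteq> Y} = insert X ?S"
    using X V_flat flat_subset_V unfolding intersection_poset_def by auto
  have VX: "(V, X) \<in> flat_order"
    using X V_flat flat_subset_V unfolding intersection_poset_def by auto
  have "finite ?S"
    by (rule finite_subset[OF _ finite_flats]) (auto simp: intersection_poset_def)
  moreover have "mobius flat_order V X = - (\<Sum>Y\<in>?S. mobius flat_order V Y)"
    using False VX finite_flats Partial_order_intersection_poset[of V A]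
    by (subst mobius.simps) auto
  ultimately show ?thesis using False unfolding eq by simp
qed

text \<open>
  By the rank computation, the value at \<open>q\<close> is the sum of \<open>\<mu>(V, X)\<close> over all pairs of a flat \<open>X\<close>
  and a test point \<open>p \<in> X\<close>. For fixed \<open>p\<close> these flats are the ones containing the smallest flat
  through \<open>p\<close>, so the inner sum vanishes unless that flat is \<open>V\<close>, which means that no
  hyperplane passes through \<open>p\<close>.
\<close>

lemma poly_char_poly_arr: "poly (char_poly_arr V A) (int q) = int (card (P - \<Union>A))"
proof -
  let ?\<mu> = "mobius flat_order V"
  have "poly (char_poly_arr V A) (int q) =
      (\<Sum>X\<in>flats. ?\<mu> X * int q ^ (poset_length flat_order - poset_rank flat_order X))"
    unfolding char_poly_arr_def char_poly_poset_def by (simp add: poly_sum poly_monom)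
  also have "\<dots> = (\<Sum>X\<in>flats. ?\<mu> X * int (card (X \<inter> P)))"
  proof (rule sum.cong)
    fix X assume X: "X \<in> flats"
    then have "flat_dim X \<le> flat_dim V" using flat_dim_mono V_flat flat_subset_V by auto
    then show "?\<mu> X * int q ^ (poset_length flat_order - poset_rank flat_order X)
        = ?\<mu> X * int (card (X \<inter> P))"
      using poset_rank_flat[OF X] poset_length_flats card_flat[OF X] by simp
  qed simp
  also have "\<dots> = (\<Sum>X\<in>flats. \<Sum>p\<in>P. if p \<in> X then ?\<mu> X else 0)"
  proof (rule sum.cong)
    fix X
    have "(\<Sum>p\<in>P. if p \<in> X then ?\<mu> X else 0) = (\<Sum>p\<in>X \<inter> P. ?\<mu> X)"
      using finite_P by (simp add: sum.inter_restrict[symmetric] Int_commute)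
    then show "?\<mu> X * int (card (X \<inter> P)) = (\<Sum>p\<in>P. if p \<in> X then ?\<mu> X else 0)" by simp
  qed simp
  also have "\<dots> = (\<Sum>p\<in>P. \<Sum>X\<in>flats. if p \<in> X then ?\<mu> X else 0)"
    by (rule sum.swap)
  also have "\<dots> = (\<Sum>p\<in>P. if p \<in> \<Union>A then 0 else 1)"
  proof (rule sum.cong)
    fix p assume p: "p \<in> P"
    let ?X = "V \<inter> \<Inter>{H \<in> A. p \<in> H}"
    have X: "?X \<in> flats" by (rule Int_flat[OF V_flat]) auto
    have iff: "p \<in> Y \<longleftrightarrow> ?X \<subseteq> Y" if "Y \<in> flats" for Y
      using that p P_sub unfolding intersections_def by auto
    have "(\<Sum>X\<in>flats. if p \<in> X then ?\<mu> X else 0) = (\<Sum>Y | Y \<in> flats \<and> ?X \<subseteq> Y. ?\<mu> Y)"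
      using iff finite_flats
      by (simp add: sum.inter_filter[symmetric] cong: conj_cong)
    also have "\<dots> = (if ?X = V then 1 else 0)" by (rule sum_mobius_lower[OF X])
    also have "?X = V \<longleftrightarrow> p \<notin> \<Union>A" using proper by blast
    finally show "(\<Sum>X\<in>flats. if p \<in> X then ?\<mu> X else 0) = (if p \<in> \<Union>A then 0 else 1)"
      by simp
  qed simp
  also have "\<dots> = (\<Sum>p\<in>P - \<Union>A. 1)"
    using finite_P by (intro sum.mono_neutral_cong_right) auto
  finally show ?thesis by simp
qed

end

section \<open>Flats of monomial arrangements\<close>

definition unit_roots :: "nat \<Rightarrow> complex set" where
  "unit_roots m = {w. w ^ m = 1}"

definition scalars :: "nat \<Rightarrow> complex set" where
  "scalars m = insert 0 (unit_roots m)"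

lemma zero_scalars [simp]: "0 \<in> scalars m" and one_scalars [simp]: "1 \<in> scalars m"
  by (auto simp: scalars_def unit_roots_def)

lemma scalars_mult: "a \<in> scalars m \<Longrightarrow> b \<in> scalars m \<Longrightarrow> a * b \<in> scalars m"
  by (auto simp: scalars_def unit_roots_def power_mult_distrib)

lemma scalars_divide: "a \<in> scalars m \<Longrightarrow> b \<in> scalars m \<Longrightarrow> a / b \<in> scalars m"
  by (auto simp: scalars_def unit_roots_def power_divide)

text \<open>
  The coordinates are functions \<open>\<xi> i\<close> on the ambient space. In solved form, the coordinates with
  index in \<open>R\<close> are free on \<open>Y\<close>, and every other one is zero or a root of unity times a free one.
  Where \<open>g i = 0\<close> the index \<open>\<rho> i\<close> is arbitrary.
\<close>

definition solved_form ::
  "nat \<Rightarrow> 'v set \<Rightarrow> 'i set \<Rightarrow> ('i \<Rightarrow> 'v \<Rightarrow> complex) \<Rightarrow> 'i set \<Rightarrow> 'v set \<Rightarrow> bool" where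
  "solved_form m V I \<xi> R Y \<longleftrightarrow> R \<subseteq> I \<and>
     (\<exists>g \<rho>. (\<forall>i\<in>I. g i \<in> scalars m \<and> (g i = 0 \<or> \<rho> i \<in> R)) \<and>
            (\<forall>r\<in>R. g r = 1 \<and> \<rho> r = r) \<and>
            Y = {v \<in> V. \<forall>i\<in>I. \<xi> i v = g i * \<xi> (\<rho> i) v})"

lemma solved_form_whole: "solved_form m V I \<xi> I V"
  unfolding solved_form_def
  by (intro conjI exI[of _ "\<lambda>_. 1"] exI[of _ "\<lambda>i. i"]) auto

text \<open>
  Substitution: every coordinate that was expressed through \<open>\<xi> r\<close> is now expressed through \<open>\<xi> s\<close>.
\<close>

lemma solved_form_eliminate:
  assumes sf: "solved_form m V I \<xi> R Y" and r: "r \<in> R" and c: "c \<in> scalars m"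
    and s: "c = 0 \<or> s \<in> R - {r}"
  shows "solved_form m V I \<xi> (R - {r}) (Y \<inter> {v. \<xi> r v = c * \<xi> s v})"
proof -
  from sf obtain g \<rho> where R: "R \<subseteq> I"
    and g: "\<forall>i\<in>I. g i \<in> scalars m \<and> (g i = 0 \<or> \<rho> i \<in> R)"
    and id: "\<forall>r\<in>R. g r = 1 \<and> \<rho> r = r"
    and Y: "Y = {v \<in> V. \<forall>i\<in>I. \<xi> i v = g i * \<xi> (\<rho> i) v}"
    unfolding solved_form_def by blast
  define g' where "g' = (\<lambda>i. if \<rho> i = r then g i * c else g i)"
  define \<rho>' where "\<rho>' = (\<lambda>i. if \<rho> i = r then s else \<rho> i)"
  have "\<forall>i\<in>I. g' i \<in> scalars m \<and> (g' i = 0 \<or> \<rho>' i \<in> R - {r})"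
    using g s c scalars_mult unfolding g'_def \<rho>'_def by auto
  moreover have "\<forall>i\<in>R - {r}. g' i = 1 \<and> \<rho>' i = i"
    using id unfolding g'_def \<rho>'_def by auto
  moreover have "Y \<inter> {v. \<xi> r v = c * \<xi> s v} = {v \<in> V. \<forall>i\<in>I. \<xi> i v = g' i * \<xi> (\<rho>' i) v}"
    (is "?L = ?R")
  proof (intro set_eqI iffI)
    fix v assume "v \<in> ?L"
    then show "v \<in> ?R" unfolding Y g'_def \<rho>'_def by (auto simp: mult.assoc)
  next
    fix v assume v: "v \<in> ?R"
    have rv: "\<xi> r v = c * \<xi> s v"
      using v r R id unfolding g'_def \<rho>'_def by auto
    have "\<xi> i v = g i * \<xi> (\<rho> i) v" if "i \<in> I" for i
      using v that rv unfolding g'_def \<rho>'_def by (auto simp: mult.assoc split: if_splits)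
    with v rv show "v \<in> ?L" unfolding Y by auto
  qed
  ultimately show ?thesis
    unfolding solved_form_def using R by blast
qed

text \<open>
  Expressed in free coordinates the new equation reads \<open>\<alpha> \<xi> r = \<beta> \<xi> s\<close> with scalars \<open>\<alpha>\<close>, \<open>\<beta>\<close>.
  It is void if \<open>\<alpha> = \<beta> = 0\<close>, or if \<open>r = s\<close> and \<open>\<alpha> = \<beta>\<close>. Otherwise it determines one free
  coordinate, either as zero or as \<open>\<beta> / \<alpha>\<close> times another one, and \<open>\<beta> / \<alpha>\<close> is again a scalar.
\<close>

lemma solved_form_Int:
  assumes sf: "solved_form m V I \<xi> R Y" and ab: "a \<in> I" "b \<in> I" and h: "h \<in> scalars m"
    and H: "H = {v \<in> V. \<xi> a v = h * \<xi> b v}"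
  shows "Y \<subseteq> H \<or> (\<exists>r\<in>R. solved_form m V I \<xi> (R - {r}) (Y \<inter> H))"
proof -
  from sf obtain g \<rho> where g: "\<forall>i\<in>I. g i \<in> scalars m \<and> (g i = 0 \<or> \<rho> i \<in> R)"
    and Y: "Y = {v \<in> V. \<forall>i\<in>I. \<xi> i v = g i * \<xi> (\<rho> i) v}"
    unfolding solved_form_def by blast
  define \<alpha> where "\<alpha> = g a"
  define \<beta> where "\<beta> = h * g b"
  define r where "r = \<rho> a"
  define s where "s = \<rho> b"
  have sc: "\<alpha> \<in> scalars m" "\<beta> \<in> scalars m"
    using g ab h scalars_mult unfolding \<alpha>_def \<beta>_def by auto
  have r: "\<alpha> \<noteq> 0 \<Longrightarrow> r \<in> R" and s: "\<beta> \<noteq> 0 \<Longrightarrow> s \<in> R"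
    using g ab unfolding \<alpha>_def \<beta>_def r_def s_def by auto
  have "v \<in> V \<and> (v \<in> H \<longleftrightarrow> \<alpha> * \<xi> r v = \<beta> * \<xi> s v)" if "v \<in> Y" for v
    using that ab unfolding H Y \<alpha>_def \<beta>_def r_def s_def by (auto simp: mult.assoc)
  then have triv: "(\<And>v. \<alpha> * \<xi> r v = \<beta> * \<xi> s v) \<Longrightarrow> Y \<subseteq> H"
    and YH: "Y \<inter> H = Y \<inter> {v. \<alpha> * \<xi> r v = \<beta> * \<xi> s v}" by blast+
  note elim = solved_form_eliminate[OF sf]
  show ?thesis
  proof (cases "\<alpha> = 0")
    case True
    show ?thesis
    proof (cases "\<beta> = 0")
      case True
      with \<open>\<alpha> = 0\<close> show ?thesis using triv by auto
    next
      case False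
      with \<open>\<alpha> = 0\<close> have "Y \<inter> H = Y \<inter> {v. \<xi> s v = 0 * \<xi> s v}" unfolding YH by auto
      with elim[OF s[OF False], of 0 s] s[OF False] show ?thesis by auto
    qed
  next
    case \<alpha>: False
    consider "\<beta> = 0 \<or> r = s \<and> \<alpha> \<noteq> \<beta>" | "r = s" "\<alpha> = \<beta>" | "\<beta> \<noteq> 0" "r \<noteq> s" by blast
    then show ?thesis
    proof cases
      case 1
      then have "\<alpha> * \<xi> r v = \<beta> * \<xi> s v \<longleftrightarrow> \<xi> r v = 0 * \<xi> r v" for v
        using \<alpha> by auto
      then have "Y \<inter> H = Y \<inter> {v. \<xi> r v = 0 * \<xi> r v}" unfolding YH by simp
      with elim[OF r[OF \<alpha>], of 0 r] r[OF \<alpha>] show ?thesis by auto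
    next
      case 2
      then show ?thesis using triv by auto
    next
      case 3
      have "\<alpha> * \<xi> r v = \<beta> * \<xi> s v \<longleftrightarrow> \<xi> r v = \<beta> / \<alpha> * \<xi> s v" for v
        using \<alpha> by (auto simp: field_simps)
      then have "Y \<inter> H = Y \<inter> {v. \<xi> r v = \<beta> / \<alpha> * \<xi> s v}" unfolding YH by simp
      with elim[OF r[OF \<alpha>], of "\<beta> / \<alpha>" s] r[OF \<alpha>] s[OF 3(1)] sc scalars_divide 3
      show ?thesis by auto
    qed
  qed
qed

text \<open>
  A test point of \<open>Y\<close> is given by its free coordinates, and these can be prescribed in \<open>K\<close> at
  will: the dependent ones then lie in \<open>K\<close> because \<open>K\<close> is closed under the scalars.
\<close>

lemma card_solved_form:
  assumes sf: "solved_form m V I \<xi> R Y" and fin: "finite I" and PV: "P \<subseteq> V"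
    and bij: "bij_betw (\<lambda>v. \<lambda>i\<in>I. \<xi> i v) P (I \<rightarrow>\<^sub>E K)"
    and K0: "0 \<in> K" and Kcl: "\<And>h z. h \<in> scalars m \<Longrightarrow> z \<in> K \<Longrightarrow> h * z \<in> K"
  shows "card (Y \<inter> P) = card K ^ card R"
proof -
  from sf obtain g \<rho> where R: "R \<subseteq> I"
    and g: "\<forall>i\<in>I. g i \<in> scalars m \<and> (g i = 0 \<or> \<rho> i \<in> R)"
    and id: "\<forall>r\<in>R. g r = 1 \<and> \<rho> r = r"
    and Y: "Y = {v \<in> V. \<forall>i\<in>I. \<xi> i v = g i * \<xi> (\<rho> i) v}"
    unfolding solved_form_def by blast
  have K: "\<xi> i v \<in> K" if "v \<in> P" "i \<in> I" for i v
    using bij_betwE[OF bij] that by (auto simp: PiE_iff)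
  have "bij_betw (\<lambda>v. \<lambda>i\<in>R. \<xi> i v) (Y \<inter> P) (R \<rightarrow>\<^sub>E K)"
    unfolding bij_betw_def
  proof (intro conjI set_eqI iffI)
    show "inj_on (\<lambda>v. \<lambda>i\<in>R. \<xi> i v) (Y \<inter> P)"
    proof (rule inj_onI)
      fix v w assume v: "v \<in> Y \<inter> P" and w: "w \<in> Y \<inter> P"
        and vw: "(\<lambda>i\<in>R. \<xi> i v) = (\<lambda>i\<in>R. \<xi> i w)"
      have eq: "\<xi> i v = \<xi> i w" if "i \<in> R" for i
        using fun_cong[OF vw, of i] that by simp
      have "\<xi> i v = \<xi> i w" if "i \<in> I" for i
      proof -
        have "\<xi> i v = g i * \<xi> (\<rho> i) v" "\<xi> i w = g i * \<xi> (\<rho> i) w"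
          using v w that unfolding Y by auto
        then show ?thesis using g eq that by auto
      qed
      then have "(\<lambda>i\<in>I. \<xi> i v) = (\<lambda>i\<in>I. \<xi> i w)" by auto
      then show "v = w" using bij v w unfolding bij_betw_def inj_on_def by auto
    qed
  next
    fix c assume "c \<in> (\<lambda>v. \<lambda>i\<in>R. \<xi> i v) ` (Y \<inter> P)"
    then show "c \<in> R \<rightarrow>\<^sub>E K" using K R by auto
  next
    fix c assume c: "c \<in> R \<rightarrow>\<^sub>E K"
    define d where "d = (\<lambda>i\<in>I. if g i = 0 then 0 else g i * c (\<rho> i))"
    have "d i \<in> K" if "i \<in> I" for i
    proof (cases "g i = 0")
      case False
      then have "c (\<rho> i) \<in> K" using g that c by (auto simp: PiE_iff)
      then show ?thesis using False g that Kcl unfolding d_def by simp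
    qed (use that K0 in \<open>simp add: d_def\<close>)
    moreover have "d \<in> extensional I" unfolding d_def by (rule restrict_extensional)
    ultimately have "d \<in> I \<rightarrow>\<^sub>E K" unfolding PiE_iff by blast
    then have "d \<in> (\<lambda>v. \<lambda>i\<in>I. \<xi> i v) ` P"
      using bij_betw_imp_surj_on[OF bij] by simp
    then obtain v where v: "v \<in> P" "(\<lambda>i\<in>I. \<xi> i v) = d"
      by (elim imageE) (erule that, rule sym)
    have \<xi>: "\<xi> i v = d i" if "i \<in> I" for i
      using fun_cong[OF v(2), of i] that by simp
    have cR: "\<xi> i v = c i" if "i \<in> R" for i
      using \<xi>[of i] id R that unfolding d_def by auto
    have "\<xi> i v = g i * \<xi> (\<rho> i) v" if "i \<in> I" for i
      using \<xi>[OF that] that cR[of "\<rho> i"] g unfolding d_def by auto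
    then have "v \<in> Y \<inter> P" using v PV unfolding Y by auto
    moreover have "c = (\<lambda>i\<in>R. \<xi> i v)"
      using cR c by (auto simp: fun_eq_iff PiE_iff extensional_def)
    ultimately show "c \<in> (\<lambda>v. \<lambda>i\<in>R. \<xi> i v) ` (Y \<inter> P)" by blast
  qed
  then have "card (Y \<inter> P) = card (R \<rightarrow>\<^sub>E K)" by (rule bij_betw_same_card)
  also have "\<dots> = card K ^ card R" using finite_subset[OF R fin] by (simp add: card_PiE)
  finally show ?thesis .
qed

text \<open>
  For equations between two coordinates the set \<open>K\<close> is as good as a finite field: only the
  multiplication by scalars is used, never an addition.
\<close>

lemma counted_monomial_arrangement:
  assumes A: "finite A" "\<And>H. H \<in> A \<Longrightarrow> \<exists>a\<in>I. \<exists>b\<in>I. \<exists>h\<in>scalars m. H = {v \<in> V. \<xi> a v = h * \<xi> b v}"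
    and proper: "\<And>H. H \<in> A \<Longrightarrow> \<not> V \<subseteq> H"
    and centre: "card (V \<inter> \<Inter>A \<inter> P) = 1"
    and fin: "finite I" and PV: "P \<subseteq> V"
    and bij: "bij_betw (\<lambda>v. \<lambda>i\<in>I. \<xi> i v) P (I \<rightarrow>\<^sub>E K)"
    and K: "finite K" "card K > 1" "0 \<in> K" "\<And>h z. h \<in> scalars m \<Longrightarrow> z \<in> K \<Longrightarrow> h * z \<in> K"
  shows "counted_arrangement V A P (card K)"
proof
  have sf: "\<exists>R. solved_form m V I \<xi> R (V \<inter> \<Inter>B)" if "B \<subseteq> A" "finite B" for B
    using that(2,1)
  proof (induction B)
    case empty
    show ?case using solved_form_whole by (auto intro!: exI)
  next
    case (insert H B)
    then obtain R where R: "solved_form m V I \<xi> R (V \<inter> \<Inter>B)" by auto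
    obtain a b h where "a \<in> I" "b \<in> I" "h \<in> scalars m" "H = {v \<in> V. \<xi> a v = h * \<xi> b v}"
      using A(2)[of H] insert.prems by auto
    note step = solved_form_Int[OF R this]
    have eq: "V \<inter> \<Inter>(insert H B) = V \<inter> \<Inter>B \<inter> H" by auto
    show ?case
    proof (cases "V \<inter> \<Inter>B \<subseteq> H")
      case True
      then have "V \<inter> \<Inter>B \<inter> H = V \<inter> \<Inter>B" by auto
      with R show ?thesis unfolding eq by auto
    next
      case False
      with step show ?thesis unfolding eq by auto
    qed
  qed
  fix X H assume X: "X \<in> intersections V A" and H: "H \<in> A" "\<not> X \<subseteq> H"
  from X sf obtain R where R: "solved_form m V I \<xi> R X"
    using finite_subset[OF _ A(1)] unfolding intersections_def by blast
  obtain a b h where "a \<in> I" "b \<in> I" "h \<in> scalars m" "H = {v \<in> V. \<xi> a v = h * \<xi> b v}"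
    using A(2)[OF H(1)] by auto
  from solved_form_Int[OF R this] H(2) obtain r
    where r: "r \<in> R" "solved_form m V I \<xi> (R - {r}) (X \<inter> H)" by auto
  have "R \<subseteq> I" using R unfolding solved_form_def by auto
  then have "card R = Suc (card (R - {r}))"
    using r(1) fin finite_subset by (metis card_Suc_Diff1)
  then show "card K * card (X \<inter> H \<inter> P) = card (X \<inter> P)"
    using card_solved_form[OF R fin PV bij K(3,4)] card_solved_form[OF r(2) fin PV bij K(3,4)]
    by simp
next
  have "finite (I \<rightarrow>\<^sub>E K)" using fin K(1) by (rule finite_PiE)
  then show "finite P" using bij_betw_finite[OF bij] by simp
qed (use A(1) PV K(2) proper centre in auto)

section \<open>Orbits of the roots of unity\<close>

definition orbit :: "nat \<Rightarrow> complex \<Rightarrow> complex set" where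
  "orbit m z = (\<lambda>w. w * z) ` unit_roots m"

definition invariant :: "nat \<Rightarrow> complex set \<Rightarrow> bool" where
  "invariant m S \<longleftrightarrow> 0 \<in> S \<and> (\<forall>z\<in>S. orbit m z \<subseteq> S)"

text \<open>
  This set stands in for a finite field with \<open>1 + mL\<close> elements.
\<close>

definition grid :: "nat \<Rightarrow> nat \<Rightarrow> complex set" where
  "grid m L = insert 0 (\<Union>c\<in>{1..L}. orbit m (of_nat c))"

lemma omega_powers:
  assumes "m \<ge> 1"
  shows "(\<lambda>p. omega m ^ p) ` {..m - 1} = unit_roots m"
proof -
  have "omega m ^ p = cis (2 * pi * real p / real m)" for p
  proof -
    have "omega m = cis (2 * pi / real m)"
      unfolding omega_def cis_conv_exp by (simp add: mult_ac)
    then show ?thesis by (simp add: DeMoivre mult_ac)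
  qed
  then have "(\<lambda>p. omega m ^ p) ` {..<m} = unit_roots m"
    using bij_betw_imp_surj_on[OF bij_betw_roots_unity[of m]] assms by (simp add: unit_roots_def)
  moreover have "{..m - 1} = {..<m}" using assms by auto
  ultimately show ?thesis by simp
qed

lemma finite_unit_roots: "m \<ge> 1 \<Longrightarrow> finite (unit_roots m)"
  unfolding unit_roots_def by (rule finite_roots_unity)

lemma unit_roots_nonzero: "m \<ge> 1 \<Longrightarrow> w \<in> unit_roots m \<Longrightarrow> w \<noteq> 0"
  unfolding unit_roots_def by (auto simp: power_0_left)

lemma unit_roots_mult: "v \<in> unit_roots m \<Longrightarrow> w \<in> unit_roots m \<Longrightarrow> v * w \<in> unit_roots m"
  unfolding unit_roots_def by (simp add: power_mult_distrib)

lemma unit_roots_divide: "v \<in> unit_roots m \<Longrightarrow> w \<in> unit_roots m \<Longrightarrow> v / w \<in> unit_roots m"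
  unfolding unit_roots_def by (simp add: power_divide)

lemma one_unit_roots: "1 \<in> unit_roots m"
  unfolding unit_roots_def by simp

lemma orbit_subset: "y \<in> orbit m z \<Longrightarrow> orbit m y \<subseteq> orbit m z"
  unfolding orbit_def using unit_roots_mult by (auto simp flip: mult.assoc)

lemma mem_orbit_sym: "m \<ge> 1 \<Longrightarrow> y \<in> orbit m z \<Longrightarrow> z \<in> orbit m y"
  unfolding orbit_def
proof (elim imageE, intro rev_image_eqI)
  fix w assume "m \<ge> 1" "w \<in> unit_roots m" "y = w * z"
  then show "1 / w \<in> unit_roots m" "z = 1 / w * y"
    using unit_roots_divide one_unit_roots unit_roots_nonzero by auto
qed

lemma card_orbit:
  assumes "m \<ge> 1" "z \<noteq> 0"
  shows "card (orbit m z) = m"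
proof -
  have "card (orbit m z) = card (unit_roots m)"
    unfolding orbit_def using assms by (intro card_image inj_onI) simp
  also have "\<dots> = m" using assms card_roots_unity_eq[of m] by (simp add: unit_roots_def)
  finally show ?thesis .
qed

lemma finite_orbit: "m \<ge> 1 \<Longrightarrow> finite (orbit m z)"
  unfolding orbit_def using finite_unit_roots by simp

lemma invariant_Un_orbit: "invariant m S \<Longrightarrow> invariant m (S \<union> orbit m z)"
  using orbit_subset unfolding invariant_def by blast

lemma card_Un_orbit:
  assumes "m \<ge> 1" "invariant m S" "finite S" "z \<notin> S"
  shows "card (S \<union> orbit m z) = card S + m"
proof -
  have "S \<inter> orbit m z = {}"
    using assms mem_orbit_sym unfolding invariant_def by blast
  moreover have "z \<noteq> 0" using assms unfolding invariant_def by auto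
  ultimately show ?thesis
    using assms by (simp add: card_Un_disjoint finite_orbit card_orbit)
qed

lemma invariant_zero: "invariant m {0}"
  unfolding invariant_def orbit_def by auto

text \<open>
  Positive integers lie in distinct orbits because roots of unity have modulus \<open>1\<close>.
\<close>

lemma grid_properties:
  assumes "m \<ge> 1"
  shows "invariant m (grid m L) \<and> finite (grid m L) \<and> card (grid m L) = 1 + m * L"
proof (induction L)
  case 0
  show ?case using invariant_zero by (simp add: grid_def)
next
  case (Suc L)
  have eq: "grid m (Suc L) = grid m L \<union> orbit m (of_nat (Suc L))"
    unfolding grid_def by (simp add: atLeastAtMostSuc_conv Un_commute)
  have "of_nat (Suc L) \<notin> grid m L"
  proof
    assume "of_nat (Suc L) \<in> grid m L"
    then obtain c w where cw: "c \<in> {1..L}" "w \<in> unit_roots m" "of_nat (Suc L) = w * of_nat c"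
      unfolding grid_def orbit_def by (auto simp del: of_nat_Suc)
    have "norm w ^ m = 1 ^ m"
      using cw(2) unfolding unit_roots_def by (simp flip: norm_power)
    then have "norm w = 1" using assms by (subst (asm) power_eq_iff_eq_base) auto
    then have "norm (of_nat (Suc L) :: complex) = norm (of_nat c :: complex)"
      unfolding cw(3) norm_mult by simp
    then have "Suc L = c" by (simp only: norm_of_nat of_nat_eq_iff)
    with cw(1) show False by simp
  qed
  then show ?case
    unfolding eq using Suc assms
    by (simp add: card_Un_orbit invariant_Un_orbit finite_orbit del: of_nat_Suc)
qed

text \<open>
  For \<open>t = q\<close> this counts the choices of \<open>N\<close> further coordinates \<open>x\<^sub>j\<close> and of \<open>k\<close> values
  avoiding zero and the orbits of all \<open>x\<^sub>j\<close>, when \<open>i\<close> nonzero orbits are already occupied: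
  the next \<open>x\<^sub>j\<close> falls into the \<open>mi + 1\<close> occupied points, or it occupies a new orbit.
\<close>

fun avoid_poly :: "nat \<Rightarrow> nat \<Rightarrow> nat \<Rightarrow> nat \<Rightarrow> int poly" where
  "avoid_poly m k 0 i = (tvar - 1 - of_nat (m * i)) ^ k"
| "avoid_poly m k (Suc N) i =
     of_nat (m * i + 1) * avoid_poly m k N i + (tvar - 1 - of_nat (m * i)) * avoid_poly m k N (Suc i)"

text \<open>
  Induction on the number of coordinates, with the set \<open>S\<close> of occupied points as parameter. A
  coordinate in \<open>S\<close> leaves \<open>S\<close> as it is, since \<open>S\<close> is invariant; one outside enlarges
  \<open>S\<close> by a full orbit of \<open>m\<close> points.
\<close>

lemma sum_avoiding:
  assumes m: "m \<ge> 1" and K: "finite K" "invariant m K" and J: "finite J"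
    and S: "S \<subseteq> K" "invariant m S" "card S = 1 + m * i"
  shows "(\<Sum>x\<in>J \<rightarrow>\<^sub>E K. int (card (K - (S \<union> (\<Union>j\<in>J. orbit m (x j))))) ^ k) =
           poly (avoid_poly m k (card J) i) (int (card K))"
  using J S
proof (induction J arbitrary: S i)
  case empty
  then have "int (card (K - S)) = int (card K) - 1 - int (m * i)"
    using K(1) card_mono[OF K(1) empty(1)] finite_subset[OF empty(1) K(1)]
    by (simp add: card_Diff_subset of_nat_diff)
  then show ?case by simp
next
  case (insert j J)
  let ?f = "\<lambda>J S x. int (card (K - (S \<union> (\<Union>j\<in>J. orbit m (x j))))) ^ k"
  let ?q = "int (card K)"
  have finS: "finite S" using finite_subset[OF insert.prems(1) K(1)] .
  have "(\<Sum>x\<in>insert j J \<rightarrow>\<^sub>E K. ?f (insert j J) S x) =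
        (\<Sum>(y, x)\<in>K \<times> (J \<rightarrow>\<^sub>E K). ?f (insert j J) S (x(j := y)))"
    unfolding PiE_insert_eq
    by (subst sum.reindex) (use insert.hyps inj_combinator[of j J "\<lambda>_. K"] in \<open>auto simp: case_prod_unfold\<close>)
  also have "\<dots> = (\<Sum>y\<in>K. \<Sum>x\<in>J \<rightarrow>\<^sub>E K. ?f (insert j J) S (x(j := y)))"
    by (simp add: sum.cartesian_product)
  also have "\<dots> = (\<Sum>y\<in>K. \<Sum>x\<in>J \<rightarrow>\<^sub>E K. ?f J (S \<union> orbit m y) x)"
  proof (intro sum.cong refl)
    fix y x
    have "(\<Union>a\<in>J. orbit m ((x(j := y)) a)) = (\<Union>a\<in>J. orbit m (x a))"
      using insert.hyps by (intro SUP_cong) auto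
    then show "?f (insert j J) S (x(j := y)) = ?f J (S \<union> orbit m y) x"
      by (simp add: Un_assoc)
  qed
  also have "\<dots> = (\<Sum>y\<in>K. if y \<in> S then poly (avoid_poly m k (card J) i) ?q
                         else poly (avoid_poly m k (card J) (Suc i)) ?q)"
  proof (intro sum.cong refl)
    fix y assume y: "y \<in> K"
    show "(\<Sum>x\<in>J \<rightarrow>\<^sub>E K. ?f J (S \<union> orbit m y) x) =
        (if y \<in> S then poly (avoid_poly m k (card J) i) ?q
                         else poly (avoid_poly m k (card J) (Suc i)) ?q)"
    proof (cases "y \<in> S")
      case True
      then have "S \<union> orbit m y = S" using insert.prems(2) unfolding invariant_def by auto
      then show ?thesis using insert.IH[OF insert.prems] True by simp
    next
      case False
      have "S \<union> orbit m y \<subseteq> K" using y K(2) insert.prems(1) unfolding invariant_def by auto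
      moreover have "card (S \<union> orbit m y) = 1 + m * Suc i"
        using card_Un_orbit[OF m insert.prems(2) finS False] insert.prems(3) by simp
      ultimately show ?thesis
        using insert.IH[of "S \<union> orbit m y" "Suc i"] invariant_Un_orbit[OF insert.prems(2)] False
        by simp
    qed
  qed
  also have "\<dots> = int (card S) * poly (avoid_poly m k (card J) i) ?q
      + int (card (K - S)) * poly (avoid_poly m k (card J) (Suc i)) ?q"
    using K(1) insert.prems(1)
    by (simp add: sum.If_cases Int_absorb1 Diff_eq[symmetric])
  also have "int (card (K - S)) = ?q - 1 - int (m * i)"
    using insert.prems card_mono[OF K(1) insert.prems(1)] finS
    by (simp add: card_Diff_subset of_nat_diff)
  finally show ?case using insert.hyps insert.prems(3) by simp
qed

section \<open>The arrangements in monomial coordinates\<close>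

text \<open>
  In the coordinates \<open>x\<^sub>2, \<dots>, x\<^sub>n\<close> and \<open>z\<^sub>l = x\<^sub>1 - y\<^sub>l\<close> the hyperplanes become
  \<open>z\<^sub>l = \<omega>\<^sup>p x\<^sub>j\<close> and \<open>z\<^sub>l = 0\<close>.
\<close>

definition coord :: "nat + nat \<Rightarrow> (nat \<Rightarrow> complex) \<times> (nat \<Rightarrow> complex) \<Rightarrow> complex" where
  "coord i v = (case i of Inl j \<Rightarrow> fst v j | Inr l \<Rightarrow> fst v 1 - snd v l)"

text \<open>
  All hyperplanes are invariant under adding a constant to \<open>x\<^sub>1\<close> and to all \<open>y\<^sub>l\<close>. The condition
  \<open>x\<^sub>1 = 0\<close> picks one representative, so that the centre contains a single test point, as the
  normalization of the characteristic polynomial by the rank requires; \<open>z\<^sub>l\<close> is then \<open>- y\<^sub>l\<close>.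
\<close>

definition grid_points ::
  "nat \<Rightarrow> nat \<Rightarrow> complex set \<Rightarrow> ((nat \<Rightarrow> complex) \<times> (nat \<Rightarrow> complex)) set" where
  "grid_points n k K = {(x, y) \<in> ambient n k.
     x 1 = 0 \<and> (\<forall>j\<in>{2..n}. x j \<in> K) \<and> (\<forall>l\<in>{1..k}. - y l \<in> K)}"

lemma bij_betw_coord:
  assumes "n \<ge> 1"
  shows "bij_betw (\<lambda>v. \<lambda>i\<in>{2..n} <+> {1..k}. coord i v) (grid_points n k K)
           (({2..n} <+> {1..k}) \<rightarrow>\<^sub>E K)"
proof (rule bij_betw_byWitness[where f' = "\<lambda>c. (\<lambda>i\<in>{1..n}. if i = 1 then 0 else c (Inl i),
                                              \<lambda>l\<in>{1..k}. - c (Inr l))"])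
  show "\<forall>v\<in>grid_points n k K. (\<lambda>i\<in>{1..n}. if i = 1 then 0 else (\<lambda>i\<in>{2..n} <+> {1..k}. coord i v) (Inl i),
      \<lambda>l\<in>{1..k}. - (\<lambda>i\<in>{2..n} <+> {1..k}. coord i v) (Inr l)) = v"
    using assms
    by (auto simp: grid_points_def ambient_def coord_def fun_eq_iff PiE_iff extensional_def
        InlI InrI)
  show "\<forall>c\<in>({2..n} <+> {1..k}) \<rightarrow>\<^sub>E K. (\<lambda>i\<in>{2..n} <+> {1..k}. coord i
      (\<lambda>i\<in>{1..n}. if i = 1 then 0 else c (Inl i), \<lambda>l\<in>{1..k}. - c (Inr l))) = c"
    using assms
    by (auto simp: coord_def fun_eq_iff PiE_iff extensional_def split: sum.splits)
  show "(\<lambda>v. \<lambda>i\<in>{2..n} <+> {1..k}. coord i v) ` grid_points n k K \<subseteq> ({2..n} <+> {1..k}) \<rightarrow>\<^sub>E K"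
    by (auto simp: grid_points_def ambient_def coord_def)
  show "(\<lambda>c. (\<lambda>i\<in>{1..n}. if i = 1 then 0 else c (Inl i), \<lambda>l\<in>{1..k}. - c (Inr l))) `
      (({2..n} <+> {1..k}) \<rightarrow>\<^sub>E K) \<subseteq> grid_points n k K"
    using assms by (auto simp: grid_points_def ambient_def PiE_iff)
qed

lemma mem_Union_arr_J:
  assumes m: "m \<ge> 1" and v: "(x, y) \<in> ambient n k" and x1: "x 1 = 0"
  shows "(x, y) \<in> \<Union>(arr_J m n k) \<longleftrightarrow>
     (\<exists>l\<in>{1..k}. - y l \<in> {0} \<union> (\<Union>j\<in>{2..n}. orbit m (x j)))"
proof -
  have "(x, y) \<in> \<Union>(arr_J m n k) \<longleftrightarrow>
     (\<exists>l\<in>{1..k}. y l = 0 \<or> (\<exists>j\<in>{2..n}. \<exists>p\<in>{..m - 1}. - (omega m ^ p * x j) = y l))"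
    (is "?L \<longleftrightarrow> ?R")
  proof
    assume ?L
    then show ?R using v x1 unfolding arr_J_def by fastforce
  next
    assume ?R
    then obtain l where l: "l \<in> {1..k}"
      and "y l = 0 \<or> (\<exists>j\<in>{2..n}. \<exists>p\<in>{..m - 1}. - (omega m ^ p * x j) = y l)" by blast
    from this(2) show ?L
    proof (elim disjE bexE)
      assume "y l = 0"
      then have "(x, y) \<in> {(x, y) \<in> ambient n k. x 1 = y l}" using v x1 by simp
      moreover have "{(x, y) \<in> ambient n k. x 1 = y l} \<in> arr_J m n k"
        unfolding arr_J_def using l by auto
      ultimately show ?L by blast
    next
      fix j p assume jp: "j \<in> {2..n}" "p \<in> {..m - 1}" "- (omega m ^ p * x j) = y l"
      then have "(x, y) \<in> {(x, y) \<in> ambient n k. x 1 - omega m ^ p * x j = y l}"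
        using v x1 by simp
      moreover have "{(x, y) \<in> ambient n k. x 1 - omega m ^ p * x j = y l} \<in> arr_J m n k"
        unfolding arr_J_def using l jp by (intro UnI1 CollectI exI[of _ j] exI[of _ p] exI[of _ l]) auto
      ultimately show ?L by blast
    qed
  qed
  also have "\<dots> \<longleftrightarrow> (\<exists>l\<in>{1..k}. - y l \<in> {0} \<union> (\<Union>j\<in>{2..n}. orbit m (x j)))"
  proof (rule bex_cong[OF refl])
    fix l
    have "- (omega m ^ p * x j) = y l \<longleftrightarrow> - y l = omega m ^ p * x j" for j p
      by (metis minus_minus)
    then have "(\<exists>p\<in>{..m - 1}. - (omega m ^ p * x j) = y l) \<longleftrightarrow> - y l \<in> orbit m (x j)" for j
      unfolding orbit_def omega_powers[OF m, symmetric] by (simp add: image_iff)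
    then show "(y l = 0 \<or> (\<exists>j\<in>{2..n}. \<exists>p\<in>{..m - 1}. - (omega m ^ p * x j) = y l)) \<longleftrightarrow>
        - y l \<in> {0} \<union> (\<Union>j\<in>{2..n}. orbit m (x j))" by auto
  qed
  finally show ?thesis .
qed

text \<open>
  Off the hyperplanes the values \<open>z\<^sub>l\<close> are chosen freely in \<open>K\<close> outside zero and the orbits
  of the \<open>x\<^sub>j\<close>.
\<close>

lemma card_complement:
  assumes m: "m \<ge> 1" and n: "n \<ge> 1" and K: "finite K" "invariant m K"
  shows "int (card (grid_points n k K - \<Union>(arr_J m n k))) =
           poly (avoid_poly m k (n - 1) 0) (int (card K))"
proof -
  let ?S = "\<lambda>x. {0} \<union> (\<Union>j\<in>{2..n}. orbit m (x j))"
  let ?B = "Sigma ({2..n} \<rightarrow>\<^sub>E K) (\<lambda>x. {1..k} \<rightarrow>\<^sub>E (K - ?S x))"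
  have "bij_betw (\<lambda>(x, y). (restrict x {2..n}, \<lambda>l\<in>{1..k}. - y l))
          (grid_points n k K - \<Union>(arr_J m n k)) ?B"
  proof (rule bij_betw_byWitness[where f' = "\<lambda>(x, z). (\<lambda>i\<in>{1..n}. if i = 1 then 0 else x i,
                                                       \<lambda>l\<in>{1..k}. - z l)"])
    show "\<forall>v\<in>grid_points n k K - \<Union>(arr_J m n k).
       (case (case v of (x, y) \<Rightarrow> (restrict x {2..n}, \<lambda>l\<in>{1..k}. - y l)) of
          (x, z) \<Rightarrow> (\<lambda>i\<in>{1..n}. if i = 1 then 0 else x i, \<lambda>l\<in>{1..k}. - z l)) = v"
      using n by (auto simp: grid_points_def ambient_def fun_eq_iff PiE_iff extensional_def)
    show "\<forall>v\<in>?B. (case (case v of (x, z) \<Rightarrow> (\<lambda>i\<in>{1..n}. if i = 1 then 0 else x i, \<lambda>l\<in>{1..k}. - z l)) of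
          (x, y) \<Rightarrow> (restrict x {2..n}, \<lambda>l\<in>{1..k}. - y l)) = v"
      using n by (auto simp: fun_eq_iff PiE_iff extensional_def)
    show "(\<lambda>(x, y). (restrict x {2..n}, \<lambda>l\<in>{1..k}. - y l)) `
        (grid_points n k K - \<Union>(arr_J m n k)) \<subseteq> ?B"
    proof (rule image_subsetI)
      fix v assume "v \<in> grid_points n k K - \<Union>(arr_J m n k)"
      then obtain x y where v: "v = (x, y)" "(x, y) \<in> ambient n k" "x 1 = 0"
          "\<forall>j\<in>{2..n}. x j \<in> K" "\<forall>l\<in>{1..k}. - y l \<in> K" "(x, y) \<notin> \<Union>(arr_J m n k)"
        unfolding grid_points_def by auto
      have "\<forall>l\<in>{1..k}. - y l \<in> K - ?S x"
        using mem_Union_arr_J[OF m v(2,3)] v(5,6) by blast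
      moreover have "?S (restrict x {2..n}) = ?S x" by simp
      ultimately show "(\<lambda>(x, y). (restrict x {2..n}, \<lambda>l\<in>{1..k}. - y l)) v \<in> ?B"
        using v(4) unfolding v(1) by (simp add: restrict_PiE_iff)
    qed
    show "(\<lambda>(x, z). (\<lambda>i\<in>{1..n}. if i = 1 then 0 else x i, \<lambda>l\<in>{1..k}. - z l)) ` ?B
        \<subseteq> grid_points n k K - \<Union>(arr_J m n k)"
    proof (rule image_subsetI)
      fix v assume "v \<in> ?B"
      then obtain x z where v: "v = (x, z)" "x \<in> {2..n} \<rightarrow>\<^sub>E K" "z \<in> {1..k} \<rightarrow>\<^sub>E (K - ?S x)"
        by auto
      define x' where "x' = (\<lambda>i\<in>{1..n}. if i = 1 then 0 else x i)"
      define y where "y = (\<lambda>l\<in>{1..k}. - z l)"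
      have amb: "(x', y) \<in> ambient n k" unfolding x'_def y_def ambient_def by simp
      have x1: "x' 1 = 0" using n unfolding x'_def by simp
      have x': "x' j = x j" if "j \<in> {2..n}" for j using that unfolding x'_def by auto
      have y: "- y l = z l" if "l \<in> {1..k}" for l using that unfolding y_def by simp
      have "?S x' = ?S x" using x' by simp
      then have "(x', y) \<notin> \<Union>(arr_J m n k)"
        using mem_Union_arr_J[OF m amb x1] y v(3) by (auto simp: PiE_iff)
      moreover have "(x', y) \<in> grid_points n k K"
        using amb x1 x' y v(2,3) unfolding grid_points_def by (auto simp: PiE_iff)
      ultimately show "(\<lambda>(x, z). (\<lambda>i\<in>{1..n}. if i = 1 then 0 else x i, \<lambda>l\<in>{1..k}. - z l)) v
        \<in> grid_points n k K - \<Union>(arr_J m n k)"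
        unfolding v(1) x'_def y_def by simp
    qed
  qed
  then have "card (grid_points n k K - \<Union>(arr_J m n k)) = card ?B"
    by (rule bij_betw_same_card)
  also have "\<dots> = (\<Sum>x\<in>{2..n} \<rightarrow>\<^sub>E K. card ({1..k} \<rightarrow>\<^sub>E (K - ?S x)))"
    using K(1) by (intro card_SigmaI) (auto intro!: finite_PiE)
  also have "\<dots> = (\<Sum>x\<in>{2..n} \<rightarrow>\<^sub>E K. card (K - ?S x) ^ k)"
    by (simp add: card_PiE)
  finally have "int (card (grid_points n k K - \<Union>(arr_J m n k))) =
      (\<Sum>x\<in>{2..n} \<rightarrow>\<^sub>E K. int (card (K - ?S x)) ^ k)" by simp
  also have "\<dots> = poly (avoid_poly m k (card {2..n}) 0) (int (card K))"
    by (rule sum_avoiding[OF m K]) (use K(2) invariant_zero in \<open>auto simp: invariant_def\<close>)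
  also have "card {2..n} = n - 1" by simp
  finally show ?thesis .
qed

lemma arr_J_monomial:
  assumes m: "m \<ge> 1" and H: "H \<in> arr_J m n k"
  shows "\<exists>a\<in>{2..n} <+> {1..k}. \<exists>b\<in>{2..n} <+> {1..k}. \<exists>h\<in>scalars m.
           H = {v \<in> ambient n k. coord a v = h * coord b v}"
  using H unfolding arr_J_def
proof (elim UnE CollectE exE conjE)
  fix j p l assume H: "H = {(x, y) \<in> ambient n k. x 1 - omega m ^ p * x j = y l}"
    and jpl: "1 < j" "j \<le> n" "p \<le> m - 1" "1 \<le> l" "l \<le> k"
  have "omega m ^ p \<in> scalars m"
    using omega_powers[OF m] jpl unfolding scalars_def unit_roots_def by auto
  moreover have "H = {v \<in> ambient n k. coord (Inr l) v = omega m ^ p * coord (Inl j) v}"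
    unfolding H coord_def by (auto simp: algebra_simps)
  ultimately show ?thesis
    using jpl by (intro bexI[of _ "Inr l"] bexI[of _ "Inl j"] bexI[of _ "omega m ^ p"]) auto
next
  fix l assume H: "H = {(x, y) \<in> ambient n k. x 1 = y l}" and l: "1 \<le> l" "l \<le> k"
  have "H = {v \<in> ambient n k. coord (Inr l) v = 0 * coord (Inr l) v}"
    unfolding H coord_def by auto
  then show ?thesis
    using l by (intro bexI[of _ "Inr l"] bexI[of _ "0::complex"]) auto
qed

lemma arr_J_proper:
  assumes "n \<ge> 1" and "H \<in> arr_J m n k"
  shows "\<not> ambient n k \<subseteq> H"
proof
  assume sub: "ambient n k \<subseteq> H"
  let ?v = "(\<lambda>i\<in>{1..n}. 0 :: complex, \<lambda>l\<in>{1..k}. 1 :: complex)"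
  have "?v \<in> ambient n k" unfolding ambient_def by simp
  with sub have "?v \<in> H" by blast
  with assms show False unfolding arr_J_def by auto
qed

lemma arr_J_centre:
  assumes n: "n \<ge> 1" and k: "k \<ge> 1" and "0 \<in> K"
  shows "ambient n k \<inter> \<Inter>(arr_J m n k) \<inter> grid_points n k K =
           {(\<lambda>i\<in>{1..n}. 0, \<lambda>l\<in>{1..k}. 0)}" (is "?L = {?o}")
proof (intro equalityI subsetI)
  fix v assume "v \<in> ?L"
  then obtain x y where v: "v = (x, y)" "(x, y) \<in> ambient n k" "x 1 = 0"
      "\<And>H. H \<in> arr_J m n k \<Longrightarrow> (x, y) \<in> H"
    unfolding grid_points_def by auto
  have y: "y l = 0" if "l \<in> {1..k}" for l
  proof -
    have "{(x, y) \<in> ambient n k. x 1 = y l} \<in> arr_J m n k"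
      using that unfolding arr_J_def by auto
    from v(4)[OF this] v(3) show ?thesis by simp
  qed
  have x: "x j = 0" if "j \<in> {1..n}" for j
  proof (cases "j = 1")
    case False
    \<comment> \<open>This is the place where at least one \<open>y\<^sub>l\<close> has to exist: it ties \<open>x\<^sub>j\<close> to \<open>x\<^sub>1\<close>.\<close>
    have "{(x, y) \<in> ambient n k. x 1 - omega m ^ 0 * x j = y 1} \<in> arr_J m n k"
      unfolding arr_J_def using that False k
      by (intro UnI1 CollectI exI[of _ j] exI[of _ 0] exI[of _ 1]) auto
    from v(4)[OF this] v(3) y[of 1] k show ?thesis by simp
  qed (use v(3) in simp)
  have "v = ?o"
    using x y v(2) unfolding v(1) ambient_def by (auto simp: fun_eq_iff PiE_iff extensional_def)
  then show "v \<in> {?o}" by simp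
next
  fix v assume "v \<in> {?o}"
  then have v: "v = ?o" by simp
  have "?o \<in> ambient n k" unfolding ambient_def by simp
  then show "v \<in> ?L"
    unfolding v using assms by (auto simp: arr_J_def grid_points_def)
qed

text \<open>
  Both sides agree at every \<open>q = 1 + mL\<close> with \<open>L \<ge> 1\<close>, hence at infinitely many points.
\<close>

lemma chi_J_eq_avoid_poly:
  assumes k: "k \<ge> 1" and m: "m \<ge> 1" and n: "n \<ge> 1"
  shows "chi_J m n k = avoid_poly m k (n - 1) 0"
proof (rule ccontr)
  let ?d = "chi_J m n k - avoid_poly m k (n - 1) 0"
  assume "chi_J m n k \<noteq> avoid_poly m k (n - 1) 0"
  then have "finite {t. poly ?d t = 0}" by (intro poly_roots_finite) simp
  moreover have "(\<lambda>L. int (1 + m * L)) ` {1..} \<subseteq> {t. poly ?d t = 0}"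
  proof (intro image_subsetI CollectI)
    fix L :: nat assume L: "L \<in> {1..}"
    let ?K = "grid m L"
    have K: "invariant m ?K" "finite ?K" "card ?K = 1 + m * L"
      using grid_properties[OF m] by auto
    have K0: "0 \<in> ?K" using K(1) unfolding invariant_def by simp
    have "counted_arrangement (ambient n k) (arr_J m n k) (grid_points n k ?K) (card ?K)"
    proof (rule counted_monomial_arrangement[where I = "{2..n} <+> {1..k}" and \<xi> = coord and m = m])
      show "card (ambient n k \<inter> \<Inter>(arr_J m n k) \<inter> grid_points n k ?K) = 1"
        unfolding arr_J_centre[OF n k K0] by simp
      show "grid_points n k ?K \<subseteq> ambient n k" unfolding grid_points_def by auto
      show "1 < card ?K" using L m K(3) by simp
      fix h z assume "h \<in> scalars m" "z \<in> ?K"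
      then show "h * z \<in> ?K"
        using K(1) K0 unfolding invariant_def orbit_def scalars_def unit_roots_def by auto
    qed (use finite_arr_J arr_J_monomial[OF m] arr_J_proper[OF n] bij_betw_coord[OF n] K K0 in auto)
    from counted_arrangement.poly_char_poly_arr[OF this]
    have "poly (chi_J m n k) (int (card ?K)) = poly (avoid_poly m k (n - 1) 0) (int (card ?K))"
      unfolding chi_J_def card_complement[OF m n K(2,1)] .
    then show "poly ?d (int (1 + m * L)) = 0" using K(3) by simp
  qed
  moreover have "infinite ((\<lambda>L. int (1 + m * L)) ` {1..})"
    using m by (subst finite_image_iff) (auto simp: inj_on_def infinite_Ici)
  ultimately show False using finite_subset by blast
qed

section \<open>The generating function\<close>

definition avoid_fps :: "nat \<Rightarrow> nat \<Rightarrow> nat \<Rightarrow> int poly fps" where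
  "avoid_fps m k i = Abs_fps (\<lambda>N. avoid_poly m k N i)"

text \<open>
  The denominators including the empty product for \<open>N = 0\<close>, which the truncated index
  \<open>n - 2\<close> in \<^const>\<open>denom\<close> cannot express; they allow the telescoping to start at \<open>0\<close>.
\<close>

definition denom_upto :: "nat \<Rightarrow> nat \<Rightarrow> int poly fps" where
  "denom_upto m N = (\<Prod>i<N. 1 - fps_const (of_nat (m * i + 1)) * fps_X)"

lemma denom_eq_denom_upto: "denom m (Suc (Suc i)) = denom_upto m (Suc i)"
  unfolding denom_def denom_upto_def by (rule prod.cong) auto

lemma denom_upto_Suc: "denom_upto m (Suc i) = denom_upto m i * (1 - fps_const (of_nat (m * i + 1)) * fps_X)"
  by (simp add: denom_upto_def)

lemma fps_nth_denom_upto_0: "fps_nth (denom_upto m N) 0 = 1"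
  by (induction N) (simp_all add: denom_upto_def)

definition denom_upto_inv :: "nat \<Rightarrow> nat \<Rightarrow> int poly fps" where
  "denom_upto_inv m N = fps_unit_inverse (denom_upto m N)"

lemma denom_upto_mult_inv: "denom_upto m N * denom_upto_inv m N = 1"
  unfolding denom_upto_inv_def by (rule fps_unit_inverse) (rule fps_nth_denom_upto_0)

lemma denom_upto_inv_Suc: "denom_upto_inv m i = denom_upto_inv m (Suc i) * (1 - fps_const (of_nat (m * i + 1)) * fps_X)"
proof -
  let ?f = "1 - fps_const (of_nat (m * i + 1) :: int poly) * fps_X"
  have "denom_upto_inv m i = denom_upto_inv m i * (denom_upto m i * ?f * denom_upto_inv m (Suc i))"
    using denom_upto_mult_inv[of m "Suc i"] by (simp add: denom_upto_Suc)
  also have "\<dots> = (denom_upto m i * denom_upto_inv m i) * (denom_upto_inv m (Suc i) * ?f)"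
    by (simp only: ac_simps)
  finally show ?thesis by (simp only: denom_upto_mult_inv mult_1_left)
qed

lemma avoid_fps_rec:
  "(1 - fps_const (of_nat (m * i + 1)) * fps_X) * avoid_fps m k i =
     fps_const ((tvar - 1 - of_nat (m * i)) ^ k) +
     fps_const (tvar - 1 - of_nat (m * i)) * fps_X * avoid_fps m k (Suc i)"
proof (rule fps_ext)
  fix N
  show "fps_nth ((1 - fps_const (of_nat (m * i + 1)) * fps_X) * avoid_fps m k i) N =
     fps_nth (fps_const ((tvar - 1 - of_nat (m * i)) ^ k) +
     fps_const (tvar - 1 - of_nat (m * i)) * fps_X * avoid_fps m k (Suc i)) N"
    by (cases N) (simp_all add: avoid_fps_def left_diff_distrib mult.assoc del: of_nat_add of_nat_mult mult_pCons_left)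
qed

text \<open>
  With \<open>a\<^sub>i = (t - 1)\<^sub>i\<^sub>,\<^sub>m u\<^sup>i / \<Prod>\<^sub>j\<^sub><\<^sub>i (1 - (mj + 1) u)\<close>, with \<open>S\<^sub>i\<close> the series \<^term>\<open>avoid_fps m k i\<close> and with
  \<open>c\<^sub>i = (t - 1 - mi)\<^sup>k\<close> its constant term, this is \<open>a\<^sub>i (S\<^sub>i - c\<^sub>i)\<close>. For \<open>i = 0\<close> it is the
  generating function in question, and it is divisible by \<open>u\<close> to the power \<open>i\<close>.
\<close>

definition series_tail :: "nat \<Rightarrow> nat \<Rightarrow> nat \<Rightarrow> int poly fps" where
  "series_tail m k i = fps_const (gfalling (tvar - 1) i m) * fps_X ^ i * denom_upto_inv m i *
     (avoid_fps m k i - fps_const ((tvar - 1 - of_nat (m * i)) ^ k))"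

lemma gfalling_Suc: "gfalling x (Suc i) m = gfalling x i m * (x - of_nat (m * i))"
  by (simp add: gfalling_def mult.commute)

text \<open>
  With \<open>d\<^sub>i = t - 1 - mi\<close> and \<open>e\<^sub>i = (mi + 1) u\<close>, the recursion \<open>(1 - e\<^sub>i) S\<^sub>i = c\<^sub>i + d\<^sub>i u S\<^sub>i\<^sub>+\<^sub>1\<close> gives
  \<open>a\<^sub>i (S\<^sub>i - c\<^sub>i) = a\<^sub>i\<^sub>+\<^sub>1 S\<^sub>i\<^sub>+\<^sub>1 + a\<^sub>i e\<^sub>i c\<^sub>i / (1 - e\<^sub>i)\<close>, because \<open>a\<^sub>i\<^sub>+\<^sub>1 = a\<^sub>i d\<^sub>i u / (1 - e\<^sub>i)\<close>. The last
  term equals \<open>a\<^sub>i\<^sub>+\<^sub>1 (mi + 1) d\<^sub>i\<^sup>k\<^sup>-\<^sup>1\<close>, since one factor \<open>d\<^sub>i\<close> of \<open>c\<^sub>i = d\<^sub>i\<^sup>k\<close> moves into \<open>a\<^sub>i\<^sub>+\<^sub>1\<close>; this is where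
  the exponent \<open>k - 1\<close> and the factor \<open>m(n - 2) + 1\<close> come from, with \<open>n = i + 2\<close>.
\<close>

lemma series_tail_step:
  assumes "k \<ge> 1"
  shows "series_tail m k i - series_tail m k (Suc i) =
    fps_const (gfalling (tvar - 1) (Suc i) m *
      ((tvar - 1 - of_nat (m * Suc i)) ^ k +
       of_nat (m * i + 1) * (tvar - 1 - of_nat (m * i)) ^ (k - 1))) *
    fps_X ^ Suc i * denom_upto_inv m (Suc i)"
proof -
  define d where "d = tvar - 1 - of_nat (m * i)"
  define d' where "d' = tvar - 1 - of_nat (m * Suc i)"
  define a where "a = fps_const (gfalling (tvar - 1) i m)"
  define e :: "int poly fps" where "e = fps_const (of_nat (m * i + 1))"
  define w where "w = denom_upto_inv m (Suc i)"
  define c where "c = fps_const d ^ (k - 1)"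
  define D where "D = fps_const d"
  have k: "fps_const (d ^ k) = D * c"
    using assms unfolding c_def D_def by (cases k) (simp_all only: fps_const_power[symmetric] power_Suc diff_Suc_1, simp)
  have gf: "fps_const (gfalling (tvar - 1) (Suc i) m) = a * D"
    unfolding a_def D_def d_def gfalling_Suc by (simp only: fps_const_mult)
  have rec: "(1 - e * fps_X) * avoid_fps m k i = D * c + D * fps_X * avoid_fps m k (Suc i)"
    using avoid_fps_rec[of m i k] unfolding d_def[symmetric] e_def[symmetric] k D_def[symmetric] .
  have inv: "denom_upto_inv m i = w * (1 - e * fps_X)"
    unfolding w_def e_def by (rule denom_upto_inv_Suc)
  have "series_tail m k i = a * fps_X ^ i * w * ((1 - e * fps_X) * avoid_fps m k i
           - (1 - e * fps_X) * (D * c))"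
    unfolding series_tail_def d_def[symmetric] k inv a_def[symmetric] by (simp only: algebra_simps)
  also have "\<dots> = a * fps_X ^ Suc i * w * (D * avoid_fps m k (Suc i) + e * (D * c))"
    unfolding rec by (simp only: power_Suc) algebra
  finally have r0: "series_tail m k i = \<dots>" .
  have r1: "series_tail m k (Suc i) =
       (a * D) * fps_X ^ Suc i * w * (avoid_fps m k (Suc i) - fps_const (d' ^ k))"
    unfolding series_tail_def d'_def[symmetric] w_def[symmetric] gf ..
  have r2: "fps_const (gfalling (tvar - 1) (Suc i) m * (d' ^ k + of_nat (m * i + 1) * d ^ (k - 1)))
      = (a * D) * (fps_const (d' ^ k) + e * c)"
    unfolding gf[symmetric] e_def c_def
    by (simp only: fps_const_mult fps_const_add fps_const_power)
  show ?thesis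
    unfolding r0 r1 d_def[symmetric] d'_def[symmetric] w_def[symmetric] r2
    by (simp only: algebra_simps)
qed

text \<open>
  Series converge coefficientwise, and each coefficient receives only finitely many
  contributions.
\<close>

lemma has_sum_fps:
  fixes f :: "nat \<Rightarrow> 'a::comm_ring_1 fps"
  assumes low: "\<And>n j. j + p < n \<Longrightarrow> fps_nth (f n) j = 0"
    and S: "\<And>j. fps_nth (\<Sum>n\<in>{n0..j + p}. f n) j = fps_nth S j"
  shows "(f has_sum S) {n0..}"
  unfolding has_sum_def
proof (rule tendsto_fpsI)
  fix j
  have "fps_nth (sum f X) j = fps_nth S j" if X: "finite X" "{n0..j + p} \<subseteq> X" "X \<subseteq> {n0..}" for X
  proof -
    have "fps_nth (sum f X) j = (\<Sum>n\<in>X. fps_nth (f n) j)" by (simp add: fps_sum_nth)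
    also have "\<dots> = (\<Sum>n\<in>{n0..j + p}. fps_nth (f n) j)"
      using X low by (intro sum.mono_neutral_right) auto
    also have "\<dots> = fps_nth S j" using S[of j] by (simp add: fps_sum_nth)
    finally show ?thesis .
  qed
  then show "eventually (\<lambda>X. fps_nth (sum f X) j = fps_nth S j) (finite_subsets_at_top {n0..})"
    unfolding eventually_finite_subsets_at_top by (intro exI[of _ "{n0..j + p}"]) auto
qed

lemma has_sum_avoid_poly:
  "((\<lambda>n. fps_const (avoid_poly m k (n - 1) 0) * fps_X ^ (n - 1)) has_sum
     avoid_fps m k 0 - fps_const ((tvar - 1) ^ k)) {2..}"
proof (rule has_sum_fps[where p = 2])
  fix n j :: nat
  show "j + 2 < n \<Longrightarrow> fps_nth (fps_const (avoid_poly m k (n - 1) 0) * fps_X ^ (n - 1)) j = 0"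
    by simp
next
  fix j
  have "fps_nth (\<Sum>n = 2..j + 2. fps_const (avoid_poly m k (n - 1) 0) * fps_X ^ (n - 1)) j
      = (\<Sum>n = 2..j + 2. if n = Suc j then avoid_poly m k j 0 else 0)"
    unfolding fps_sum_nth by (rule sum.cong) auto
  also have "\<dots> = fps_nth (avoid_fps m k 0 - fps_const ((tvar - 1) ^ k)) j"
    by (cases j) (simp_all add: avoid_fps_def)
  finally show "fps_nth (\<Sum>n = 2..j + 2. fps_const (avoid_poly m k (n - 1) 0) * fps_X ^ (n - 1)) j
      = fps_nth (avoid_fps m k 0 - fps_const ((tvar - 1) ^ k)) j" .
qed

lemma series_tail_0: "series_tail m k 0 = avoid_fps m k 0 - fps_const ((tvar - 1) ^ k)"
  using denom_upto_mult_inv[of m 0] by (simp add: series_tail_def gfalling_def denom_upto_def)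

lemma has_sum_telescope:
  assumes "k \<ge> 1"
  shows "((\<lambda>n. fps_const (gfalling (tvar - 1) (n - 1) m *
      ((tvar - 1 - of_nat (m * (n - 1))) ^ k +
       of_nat (m * (n - 2) + 1) * (tvar - 1 - of_nat (m * (n - 2))) ^ (k - 1))) *
    fps_X ^ (n - 1) * fps_unit_inverse (denom m n)) has_sum
     avoid_fps m k 0 - fps_const ((tvar - 1) ^ k)) {2..}" (is "(?G has_sum _) _")
proof (rule has_sum_fps[where p = 2])
  fix n j :: nat
  assume "j + 2 < n"
  then show "fps_nth (?G n) j = 0"
    by (simp add: fps_X_power_mult_nth mult.assoc)
next
  fix j
  have G: "?G (i + 2) = series_tail m k i - series_tail m k (Suc i)" for i
    unfolding series_tail_step[OF assms] denom_upto_inv_def by (simp add: denom_eq_denom_upto)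
  have "(\<Sum>n = 2..j + 2. ?G n) = (\<Sum>i\<le>j. ?G (i + 2))"
    using sum.shift_bounds_cl_nat_ivl[of ?G 0 2 j] by (simp only: add_0 atMost_atLeast0)
  also have "\<dots> = series_tail m k 0 - series_tail m k (Suc j)"
    unfolding G by (rule sum_telescope)
  finally show "fps_nth (\<Sum>n = 2..j + 2. ?G n) j =
      fps_nth (avoid_fps m k 0 - fps_const ((tvar - 1) ^ k)) j"
    unfolding series_tail_0 by (simp add: series_tail_def fps_X_power_mult_nth mult.assoc)
qed

theorem theorem5p6:
  fixes k m :: nat
  assumes "k \<ge> 1" and "m \<ge> 1"
  defines "F \<equiv> \<lambda>n. fps_const (chi_J m n k) * fps_X ^ (n - 1)"
  defines "G \<equiv> \<lambda>n.
    fps_const (gfalling (tvar - 1) (n - 1) m *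
      ((tvar - 1 - of_nat (m * (n - 1))) ^ k +
       of_nat (m * (n - 2) + 1) * (tvar - 1 - of_nat (m * (n - 2))) ^ (k - 1))) *
    fps_X ^ (n - 1) * fps_unit_inverse (denom m n)"
  shows "chi_J m 1 k = (tvar - 1) ^ k \<and>
    F summable_on {2..} \<and> G summable_on {2..} \<and>
    (\<Sum>\<^sub>\<infinity>n\<in>{2..}. F n) = (\<Sum>\<^sub>\<infinity>n\<in>{2..}. G n)"
proof -
  let ?s = "avoid_fps m k 0 - fps_const ((tvar - 1) ^ k)"
  have "F n = fps_const (avoid_poly m k (n - 1) 0) * fps_X ^ (n - 1)" if "n \<in> {2..}" for n
    unfolding F_def using that chi_J_eq_avoid_poly[OF assms(1,2)] by simp
  then have F: "(F has_sum ?s) {2..}"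
    using has_sum_avoid_poly[of m k] by (subst has_sum_cong)
  have G: "(G has_sum ?s) {2..}"
    unfolding G_def by (rule has_sum_telescope[OF assms(1)])
  have "chi_J m 1 k = (tvar - 1) ^ k"
    using chi_J_eq_avoid_poly[OF assms(1,2), of 1] by simp
  moreover have "F summable_on {2..}" "G summable_on {2..}"
    using F G by (auto simp: summable_on_def)
  moreover have "infsum F {2..} = infsum G {2..}"
    using F G by (simp add: infsumI)
  ultimately show ?thesis by blast
qed

end
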